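(* Let $n\ge 1$ and let $\lambda$ be a partition of expanse $n+1$, and let $(\tau_1,\dots,\tau_n)=\phi(\lambda)\in\{0,1\}^n$. Then $$F_\lambda(q)=W_1\Big(\prod_{i=1}^n\big(\tau_iD_1+(1-\tau_i)E_1\big)\Big)V_1,$$ where the product is taken in order $i=1,\dots,n$ from left to right. Moreover, the generating function $F^{n+1}(q)=\sum_{\mathcal T}q^{\mathrm{wt}(\mathcal T)}\alpha^{-f(\mathcal T)}\beta^{-u(\mathcal T)}$, summed over all permutation tableaux $\mathcal T$ of expanse $n+1$, equals $W_1(D_1+E_1)^nV_1$.
   Context: A partition $\lambda=(\lambda_1\ge\dots\ge\lambda_k\ge0)$ is allowed to have parts equal to $0$, and partitions differing in their number of zero parts are distinguished. Its Young diagram has $k$ left-justified rows, row $i$ (from the top) having $\lambda_i$ boxes; it has $\lambda_1$ columns. The expanse of $\lambda$ is $k+\lambda_1$ (number of rows plus number of columns). The boundary of the diagram, read from the north-east corner to the south-west corner, is a word $p=p_1\cdots p_{k+\lambda_1}$ in unit steps $S$ (south) and $W$ (west), with $p_1=S$; this gives a bijection between partitions of expanse $n+1$ and words in $\{S,W\}^{n+1}$ starting with $S$ (explicitly, if $p$ has $k$ letters $S$ and $m$ letters $W$ and the $j$-th $S$ is preceded by $w_j$ letters $W$, the partition is $(m-w_1,\dots,m-w_k)$). Define $\phi(\lambda)=(\tau_1,\dots,\tau_n)\in\{0,1\}^n$ by $\tau_i=1$ iff $p_{i+1}=S$. A permutation tableau of shape $\lambda$ is a filling of the boxes of the Young diagram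 of $\lambda$ with $0$'s and $1$'s such that (1) every column contains at least one $1$, and (2) there is no $0$ which has a $1$ above it in the same column and a $1$ to its left in the same row. Its expanse is that of $\lambda$. For such a tableau $\mathcal T$ with $m$ columns: $\mathrm{wt}(\mathcal T)$ is the number of $1$'s minus $m$; $f(\mathcal T)$ is the number of $1$'s in the top row; an entry is restricted if it is a $0$ lying below some $1$ in its column, a row is unrestricted if it contains no restricted entry, and $u(\mathcal T)$ is the number of unrestricted rows minus $1$. Define $F_\lambda(q)=\sum_{\mathcal T}q^{\mathrm{wt}(\mathcal T)}\alpha^{-f(\mathcal T)}\beta^{-u(\mathcal T)}$, the sum over all permutation tableaux of shape $\lambda$. $D_1=(d_{ij})_{i,j\ge1}$ is the infinite matrix with $d_{i,i+1}=\beta^{-1}$ and all other entries $0$. $E_1=(e_{ij})_{i,j\ge1}$ has $e_{ij}=\beta^{i-j}\big(\alpha^{-1}q^{j-1}\binom{i-1}{j-1}+\sum_{r=0}^{j-2}\binom{i-j+r}{r}q^r\big)$ for $j\le i$ and $e_{ij}=0$ for $j>i$. $W_1=(1,0,0,\dots)$ and $V_1=(1,1,1,\dots)^T$. All products are well defined (only finitely many nonzero terms occur in each sum), so $W_1MV_1$ is the (finite) sum of the entries of the top row of $M$. *)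

theory Defs
  imports Main "HOL-Library.FuncSet" "HOL-Library.Groups_Big_Fun"
begin

(* Partitions are weakly decreasing lists; parts equal to 0 are allowed and significant.
   Rows and columns of diagrams are numbered from 0. *)

definition is_partition :: "nat list \<Rightarrow> bool" where
  "is_partition lam \<longleftrightarrow> sorted_wrt (\<ge>) lam"

fun num_columns :: "nat list \<Rightarrow> nat" where
  "num_columns [] = 0"
| "num_columns (a # lam) = a"

definition expanse :: "nat list \<Rightarrow> nat" where
  "expanse lam = length lam + num_columns lam"

definition boxes :: "nat list \<Rightarrow> (nat \<times> nat) set" where
  "boxes lam = {(i, j). i < length lam \<and> j < lam ! i}"

datatype step = South | West

(* Boundary path from the north-east to the south-west corner: one South step along the right
   end of each row, followed by the West steps down to the length of the next row. *)
fun boundary :: "nat list \<Rightarrow> step list" where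
  "boundary [] = []"
| "boundary (a # lam) = South # replicate (a - num_columns lam) West @ boundary lam"

lemma length_boundary:
  "is_partition lam \<Longrightarrow> length (boundary lam) = expanse lam"
proof (induction lam)
  case (Cons a lam)
  then show ?case
    by (cases lam) (auto simp: is_partition_def expanse_def)
qed (simp add: expanse_def)

(* phi lam i is tau_i for 1 <= i <= n.  List positions start at 0, so position i of the
   boundary word is the letter p_(i+1). *)
definition phi :: "nat list \<Rightarrow> nat \<Rightarrow> 'a::zero_neq_one" where
  "phi lam i = (if boundary lam ! i = South then 1 else 0)"

type_synonym filling = "nat \<times> nat \<Rightarrow> nat"

definition one_above :: "nat list \<Rightarrow> filling \<Rightarrow> nat \<Rightarrow> nat \<Rightarrow> bool" where
  "one_above lam T i j \<longleftrightarrow> (\<exists>i'<i. (i', j) \<in> boxes lam \<and> T (i', j) = 1)"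

definition one_left :: "nat list \<Rightarrow> filling \<Rightarrow> nat \<Rightarrow> nat \<Rightarrow> bool" where
  "one_left lam T i j \<longleftrightarrow> (\<exists>j'<j. (i, j') \<in> boxes lam \<and> T (i, j') = 1)"

(* Fillings are extensional, so that each is counted exactly once. *)
definition permutation_tableaux :: "nat list \<Rightarrow> filling set" where
  "permutation_tableaux lam =
     {T \<in> boxes lam \<rightarrow>\<^sub>E {0, 1}.
        (\<forall>j < num_columns lam. \<exists>i. (i, j) \<in> boxes lam \<and> T (i, j) = 1) \<and>
        (\<forall>(i, j) \<in> boxes lam. T (i, j) = 0 \<longrightarrow> \<not> (one_above lam T i j \<and> one_left lam T i j))}"

(* The truncated subtractions in wt and unr are exact for permutation tableaux of nonempty
   shape: every column contains a 1, and the top row is unrestricted. *)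
definition wt :: "nat list \<Rightarrow> filling \<Rightarrow> nat" where
  "wt lam T = card {b \<in> boxes lam. T b = 1} - num_columns lam"

definition top_ones :: "nat list \<Rightarrow> filling \<Rightarrow> nat" where
  "top_ones lam T = card {j. (0, j) \<in> boxes lam \<and> T (0, j) = 1}"

definition restricted :: "nat list \<Rightarrow> filling \<Rightarrow> nat \<Rightarrow> nat \<Rightarrow> bool" where
  "restricted lam T i j \<longleftrightarrow> (i, j) \<in> boxes lam \<and> T (i, j) = 0 \<and> one_above lam T i j"

definition unr :: "nat list \<Rightarrow> filling \<Rightarrow> nat" where
  "unr lam T = card {i. i < length lam \<and> (\<forall>j. \<not> restricted lam T i j)} - 1"

definition tableau_weight ::
    "'a::field \<Rightarrow> 'a \<Rightarrow> 'a \<Rightarrow> nat list \<Rightarrow> filling \<Rightarrow> 'a" where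
  "tableau_weight \<alpha> \<beta> q lam T =
     q ^ wt lam T * inverse \<alpha> ^ top_ones lam T * inverse \<beta> ^ unr lam T"

definition F_shape :: "'a::field \<Rightarrow> 'a \<Rightarrow> 'a \<Rightarrow> nat list \<Rightarrow> 'a" where
  "F_shape \<alpha> \<beta> q lam = (\<Sum>T \<in> permutation_tableaux lam. tableau_weight \<alpha> \<beta> q lam T)"

(* A tableau carries its shape: shapes differing only in zero parts have the same boxes. *)
definition tableaux_of_expanse :: "nat \<Rightarrow> (nat list \<times> filling) set" where
  "tableaux_of_expanse N =
     {(lam, T). is_partition lam \<and> expanse lam = N \<and> T \<in> permutation_tableaux lam}"

definition F_expanse :: "'a::field \<Rightarrow> 'a \<Rightarrow> 'a \<Rightarrow> nat \<Rightarrow> 'a" where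
  "F_expanse \<alpha> \<beta> q N = (\<Sum>(lam, T) \<in> tableaux_of_expanse N. tableau_weight \<alpha> \<beta> q lam T)"

(* Infinite matrices and vectors are indexed from 0, i.e. entry (i, j) here is the entry
   (i+1, j+1) in the usual numbering.  Sum_any adds up the nonzero terms, which are finite in
   number for all products of the row-finite matrices D1 and E1 below. *)
type_synonym 'a inf_mat = "nat \<Rightarrow> nat \<Rightarrow> 'a"
type_synonym 'a inf_vec = "nat \<Rightarrow> 'a"

definition mat_add :: "'a::comm_ring_1 inf_mat \<Rightarrow> 'a inf_mat \<Rightarrow> 'a inf_mat" where
  "mat_add A B = (\<lambda>i j. A i j + B i j)"

definition mat_scale :: "'a::comm_ring_1 \<Rightarrow> 'a inf_mat \<Rightarrow> 'a inf_mat" where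
  "mat_scale c A = (\<lambda>i j. c * A i j)"

definition mat_mul :: "'a::comm_ring_1 inf_mat \<Rightarrow> 'a inf_mat \<Rightarrow> 'a inf_mat" where
  "mat_mul A B = (\<lambda>i j. Sum_any (\<lambda>k. A i k * B k j))"

definition mat_one :: "'a::comm_ring_1 inf_mat" where
  "mat_one = (\<lambda>i j. if i = j then 1 else 0)"

definition mat_prod_list :: "'a::comm_ring_1 inf_mat list \<Rightarrow> 'a inf_mat" where
  "mat_prod_list As = foldr mat_mul As mat_one"

fun mat_pow :: "'a::comm_ring_1 inf_mat \<Rightarrow> nat \<Rightarrow> 'a inf_mat" where
  "mat_pow A 0 = mat_one"
| "mat_pow A (Suc n) = mat_mul A (mat_pow A n)"

definition row_mat_col :: "'a::comm_ring_1 inf_vec \<Rightarrow> 'a inf_mat \<Rightarrow> 'a inf_vec \<Rightarrow> 'a" where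
  "row_mat_col w M v = Sum_any (\<lambda>i. w i * Sum_any (\<lambda>j. M i j * v j))"

definition D1 :: "'a::field \<Rightarrow> 'a inf_mat" where
  "D1 \<beta> = (\<lambda>i j. if j = i + 1 then inverse \<beta> else 0)"

definition E1 :: "'a::field \<Rightarrow> 'a \<Rightarrow> 'a \<Rightarrow> 'a inf_mat" where
  "E1 \<alpha> \<beta> q = (\<lambda>i j.
     if j \<le> i
     then \<beta> ^ (i - j) *
       (inverse \<alpha> * q ^ j * of_nat (i choose j) + (\<Sum>r<j. of_nat ((i - j + r) choose r) * q ^ r))
     else 0)"

definition W1 :: "'a::comm_ring_1 inf_vec" where
  "W1 = (\<lambda>i. if i = 0 then 1 else 0)"

definition V1 :: "'a::comm_ring_1 inf_vec" where
  "V1 = (\<lambda>i. 1)"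

end

theory Submission
  imports Defs
begin

text \<open>
  Reading the boundary path from the north-east corner, a South step appends an empty row at the
  bottom of the diagram and a West step prepends a full column on the left. The matrices record the
  number of unrestricted rows (minus one). An empty row is unrestricted, which is the action of
  \<open>D1\<close>. In a new leftmost column the ones may be placed exactly at an arbitrary nonempty set
  \<open>S\<close> of unrestricted rows, and the rows that stay unrestricted are those in \<open>S\<close> and those
  above all of \<open>S\<close>; counting the sets \<open>S\<close> by size and by the number of surviving rows gives
  the entries of \<open>E1\<close>. Summing the tableau weights against an arbitrary vector of the
  state turns these two observations into an induction along the path.
\<close>

section \<open>Row-finite matrices acting on vectors\<close>

text \<open>\<open>Sum_any\<close> yields 0 on an infinite support. Under this condition the sums in
  products and in the action on vectors are genuine finite sums.\<close>

definition row_finite :: "'a::comm_ring_1 inf_mat \<Rightarrow> bool" where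
  "row_finite A \<longleftrightarrow> (\<forall>i. finite {j. A i j \<noteq> 0})"

definition mat_vec :: "'a::comm_ring_1 inf_mat \<Rightarrow> 'a inf_vec \<Rightarrow> 'a inf_vec" where
  "mat_vec A v = (\<lambda>i. Sum_any (\<lambda>j. A i j * v j))"

lemma mat_vec_eq_sum:
  assumes "finite K" "{j. A i j \<noteq> 0} \<subseteq> K"
  shows "mat_vec A v i = (\<Sum>j\<in>K. A i j * v j)"
  unfolding mat_vec_def using assms by (intro Sum_any.expand_superset) auto

lemma mat_mul_eq_sum:
  assumes "finite K" "{j. A i j \<noteq> 0} \<subseteq> K"
  shows "mat_mul A B i l = (\<Sum>j\<in>K. A i j * B j l)"
  unfolding mat_mul_def using assms by (intro Sum_any.expand_superset) auto

text \<open>This bound gives closure of row-finiteness under products, and also one finite column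
  range on which the double sum for a product can be swapped.\<close>

lemma mat_mul_support:
  assumes "row_finite A"
  shows "{j. mat_mul A B i j \<noteq> 0} \<subseteq> (\<Union>k\<in>{k. A i k \<noteq> 0}. {j. B k j \<noteq> 0})"
proof
  fix j assume "j \<in> {j. mat_mul A B i j \<noteq> 0}"
  then have "(\<Sum>k | A i k \<noteq> 0. A i k * B k j) \<noteq> 0"
    using assms mat_mul_eq_sum[of "{k. A i k \<noteq> 0}" A i B j] by (simp add: row_finite_def)
  then obtain k where "A i k \<noteq> 0" "A i k * B k j \<noteq> 0"
    by (auto elim: sum.not_neutral_contains_not_neutral)
  then show "j \<in> (\<Union>k\<in>{k. A i k \<noteq> 0}. {j. B k j \<noteq> 0})"
    by auto
qed

lemma row_finite_mat_mul:
  assumes "row_finite A" "row_finite B"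
  shows "row_finite (mat_mul A B)"
  unfolding row_finite_def
  using finite_subset[OF mat_mul_support[OF assms(1), of B]] assms by (simp add: row_finite_def)

text \<open>Associativity by exchanging two finite sums: \<open>K\<close> is the support of row
  \<open>i\<close> of \<open>A\<close>, and \<open>J\<close> contains the support of every row of
  \<open>B\<close> reached through \<open>K\<close>. It turns the matrix product of the theorem into
  an iterated action on \<open>V1\<close>.\<close>

lemma mat_vec_mat_mul:
  assumes "row_finite A" "row_finite B"
  shows "mat_vec (mat_mul A B) v = mat_vec A (mat_vec B v)"
proof
  fix i
  define K where "K = {k. A i k \<noteq> 0}"
  define J where "J = (\<Union>k\<in>K. {j. B k j \<noteq> 0})"
  have K: "finite K" and J: "finite J"
    using assms by (auto simp: K_def J_def row_finite_def)
  have "mat_vec (mat_mul A B) v i = (\<Sum>j\<in>J. (\<Sum>k\<in>K. A i k * B k j) * v j)"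
    using mat_mul_support[OF assms(1), of B i] K
    by (subst mat_vec_eq_sum[OF J]) (auto simp: J_def K_def mat_mul_eq_sum)
  also have "\<dots> = (\<Sum>k\<in>K. A i k * (\<Sum>j\<in>J. B k j * v j))"
    by (simp add: sum_distrib_left sum_distrib_right mult.assoc) (rule sum.swap)
  also have "\<dots> = (\<Sum>k\<in>K. A i k * mat_vec B v k)"
    by (intro sum.cong refl arg_cong2[where f = times] mat_vec_eq_sum[symmetric] J)
      (auto simp: J_def)
  also have "\<dots> = mat_vec A (mat_vec B v) i"
    using K by (subst mat_vec_eq_sum[OF K]) (auto simp: K_def)
  finally show "mat_vec (mat_mul A B) v i = mat_vec A (mat_vec B v) i" .
qed

lemma row_finite_mat_one: "row_finite mat_one"
  by (simp add: row_finite_def mat_one_def)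

lemma mat_vec_mat_one: "mat_vec mat_one v = v"
proof
  show "mat_vec mat_one v i = v i" for i
    by (subst mat_vec_eq_sum[of "{i}"]) (auto simp: mat_one_def)
qed

lemma row_finite_mat_prod_list:
  "(\<And>A. A \<in> set As \<Longrightarrow> row_finite A) \<Longrightarrow> row_finite (mat_prod_list As)"
  by (induction As) (auto simp: mat_prod_list_def row_finite_mat_one row_finite_mat_mul)

lemma mat_vec_mat_prod_list:
  assumes "\<And>A. A \<in> set As \<Longrightarrow> row_finite A"
  shows "mat_vec (mat_prod_list As) v = foldr mat_vec As v"
  using assms
proof (induction As)
  case Nil
  then show ?case by (simp add: mat_prod_list_def mat_vec_mat_one)
next
  case (Cons A As)
  have "mat_prod_list (A # As) = mat_mul A (mat_prod_list As)"
    by (simp add: mat_prod_list_def)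
  then show ?case
    using Cons by (simp add: mat_vec_mat_mul row_finite_mat_prod_list)
qed

lemma mat_pow_eq_mat_prod_list: "mat_pow A n = mat_prod_list (replicate n A)"
  by (induction n) (simp_all add: mat_prod_list_def)

lemma row_mat_col_W1: "row_mat_col W1 M v = mat_vec M v 0"
proof -
  have "row_mat_col W1 M v = (\<Sum>i\<in>{0}. W1 i * mat_vec M v i)"
    unfolding row_mat_col_def mat_vec_def
    by (rule Sum_any.expand_superset) (auto simp: W1_def)
  then show ?thesis by (simp add: W1_def)
qed

lemma row_finite_D1: "row_finite (D1 \<beta>)"
  by (simp add: row_finite_def D1_def)

lemma mat_vec_D1: "mat_vec (D1 \<beta>) v i = inverse \<beta> * v (Suc i)"
  by (subst mat_vec_eq_sum[of "{Suc i}"]) (auto simp: D1_def)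

lemma E1_support: "{j. E1 \<alpha> \<beta> q i j \<noteq> 0} \<subseteq> {..i}"
  by (auto simp: E1_def split: if_splits)

lemma row_finite_E1: "row_finite (E1 \<alpha> \<beta> q)"
  by (simp add: row_finite_def finite_subset[OF E1_support])

lemma row_finite_mat_add:
  assumes "row_finite A" "row_finite B"
  shows "row_finite (mat_add A B)"
  unfolding row_finite_def
proof
  fix i
  have "{j. mat_add A B i j \<noteq> 0} \<subseteq> {j. A i j \<noteq> 0} \<union> {j. B i j \<noteq> 0}"
    by (auto simp: mat_add_def)
  then show "finite {j. mat_add A B i j \<noteq> 0}"
    by (rule finite_subset) (use assms in \<open>simp add: row_finite_def\<close>)
qed

lemma mat_vec_mat_add:
  assumes "row_finite A" "row_finite B"
  shows "mat_vec (mat_add A B) v i = mat_vec A v i + mat_vec B v i"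
proof -
  define K where "K = {j. A i j \<noteq> 0} \<union> {j. B i j \<noteq> 0}"
  have K: "finite K"
    using assms by (simp add: K_def row_finite_def)
  show ?thesis
    by (subst (1 2 3) mat_vec_eq_sum[OF K])
      (auto simp: K_def mat_add_def sum.distrib algebra_simps)
qed

section \<open>Subsets counted by their surviving elements\<close>

text \<open>For \<open>U\<close> the unrestricted rows and \<open>S\<close> the rows with a 1 in a
  new leftmost column, a row is lost exactly when its new entry is a 0 below some 1 of that
  column.\<close>

definition survivors :: "nat set \<Rightarrow> nat set \<Rightarrow> nat set" where
  "survivors U S = {r \<in> U. r \<in> S \<or> (\<forall>s\<in>S. r \<le> s)}"

text \<open>The least row \<open>b\<close> always survives. If it carries no 1, it does not affect
  the rows below it; if it carries a 1, every other row needs its own 1 to survive.\<close>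

lemma survivors_insert_min:
  assumes "\<And>a. a \<in> A \<Longrightarrow> b < a" "S \<subseteq> A"
  shows "survivors (insert b A) S = insert b (survivors A S)"
    and "survivors (insert b A) (insert b S) = insert b S"
  using assms by (fastforce simp: survivors_def)+

lemma card_survivors_insert_min:
  assumes "finite A" "\<And>a. a \<in> A \<Longrightarrow> b < a" "S \<subseteq> A"
  shows "card (survivors (insert b A) S) = Suc (card (survivors A S))"
    and "card (survivors (insert b A) (insert b S)) = Suc (card S)"
proof -
  have "b \<notin> A" using assms(2) by blast
  then have "b \<notin> survivors A S" "b \<notin> S" "finite (survivors A S)" "finite S"
    using assms by (auto simp: survivors_def intro: finite_subset)
  then show "card (survivors (insert b A) S) = Suc (card (survivors A S))"
    and "card (survivors (insert b A) (insert b S)) = Suc (card S)"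
    using assms by (simp_all add: survivors_insert_min)
qed

text \<open>Subsets are split by whether they contain \<open>b\<close>; those that do are nonempty
  automatically, so the second sum includes the empty set.\<close>

lemma sum_nonempty_subsets_insert:
  assumes "finite A" "b \<notin> A"
  shows "(\<Sum>S\<in>Pow (insert b A) - {{}}. h S) =
    (\<Sum>S\<in>Pow A - {{}}. h S) + (\<Sum>S\<in>Pow A. h (insert b S) :: 'a::comm_monoid_add)"
proof -
  have eq: "Pow (insert b A) - {{}} = (Pow A - {{}}) \<union> insert b ` Pow A"
    by (auto simp: Pow_insert)
  have inj: "inj_on (insert b) (Pow A)"
    using assms(2) by (auto simp: inj_on_def)
  show ?thesis
    unfolding eq using assms
    by (subst sum.union_disjoint) (auto simp: sum.reindex[OF inj] o_def)
qed

lemma sum_Pow_card: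
  fixes f :: "nat \<Rightarrow> 'a::comm_semiring_1"
  assumes "finite A"
  shows "(\<Sum>S\<in>Pow A. f (card S)) = (\<Sum>j\<le>card A. of_nat (card A choose j) * f j)"
proof -
  have "(\<Sum>S\<in>Pow A. f (card S)) = (\<Sum>j\<le>card A. \<Sum>S | S \<in> Pow A \<and> card S = j. f (card S))"
    using assms by (intro sum.group[symmetric]) (auto intro: card_mono)
  also have "\<dots> = (\<Sum>j\<le>card A. of_nat (card A choose j) * f j)"
    using assms by (intro sum.cong refl) (simp add: n_subsets)
  finally show ?thesis .
qed

text \<open>Reading off coefficients, \<open>(card U - j + r) choose r\<close> is the number of sets
  \<open>S\<close> of size \<open>r + 1\<close> that leave \<open>j\<close> survivors. The induction
  adds a new topmost row \<open>b\<close>: sets avoiding \<open>b\<close> shift the survivor count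
  by one, which is why \<open>g\<close> is generalised, and for sets containing \<open>b\<close> the
  survivors are \<open>S\<close> itself.\<close>

lemma sum_survivors:
  fixes q :: "'a::comm_semiring_1"
  assumes "finite U"
  shows "(\<Sum>S\<in>Pow U - {{}}. q ^ (card S - 1) * g (card (survivors U S))) =
    (\<Sum>j\<le>card U. (\<Sum>r<j. of_nat ((card U - j + r) choose r) * q ^ r) * g j)"
  using assms
proof (induction U arbitrary: g rule: finite_linorder_min_induct)
  case empty
  then show ?case by simp
next
  case (insert b A)
  note fin = \<open>finite A\<close>
  have less: "\<And>a. a \<in> A \<Longrightarrow> b < a" and b: "b \<notin> A"
    using insert.hyps by auto
  let ?i = "card A"
  have "(\<Sum>S\<in>Pow (insert b A) - {{}}. q ^ (card S - 1) * g (card (survivors (insert b A) S))) =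
    (\<Sum>S\<in>Pow A - {{}}. q ^ (card S - 1) * g (Suc (card (survivors A S)))) +
    (\<Sum>S\<in>Pow A. q ^ card S * g (Suc (card S)))"
    unfolding sum_nonempty_subsets_insert[OF fin b]
  proof (intro arg_cong2[where f = plus] sum.cong refl)
    fix S assume "S \<in> Pow A"
    moreover from this have "finite S" "b \<notin> S"
      using fin b by (auto intro: finite_subset)
    ultimately show "q ^ (card (insert b S) - 1) * g (card (survivors (insert b A) (insert b S))) =
        q ^ card S * g (Suc (card S))"
      by (simp add: card_survivors_insert_min[OF fin less])
  qed (simp add: card_survivors_insert_min[OF fin less])
  also have "\<dots> = (\<Sum>j\<le>?i. (\<Sum>r<j. of_nat ((?i - j + r) choose r) * q ^ r) * g (Suc j)) +
      (\<Sum>j\<le>?i. of_nat (?i choose j) * (q ^ j * g (Suc j)))"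
    using insert.IH[of "\<lambda>j. g (Suc j)"] sum_Pow_card[OF fin, of "\<lambda>j. q ^ j * g (Suc j)"]
    by simp
  \<comment> \<open>The sets containing \<open>b\<close> supply precisely the missing term
    \<open>r = j\<close>, because \<open>?i - j + j = ?i\<close>.\<close>
  also have "\<dots> = (\<Sum>j\<le>?i. (\<Sum>r<Suc j. of_nat ((?i - j + r) choose r) * q ^ r) * g (Suc j))"
    by (simp add: sum.distrib[symmetric] algebra_simps)
  \<comment> \<open>Shifting \<open>j\<close> by one is harmless: the extra term
    \<open>j = 0\<close> has an empty inner sum.\<close>
  also have "\<dots> = (\<Sum>j\<le>Suc ?i. (\<Sum>r<j. of_nat ((Suc ?i - j + r) choose r) * q ^ r) * g j)"
    by (subst sum.atMost_Suc_shift) simp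
  finally show ?case
    using fin b by simp
qed

text \<open>The two summands of an entry of \<open>E1\<close> correspond to the top row 0 having a 1
  or a 0 in the new column. With a 1, the survivors are \<open>S\<close>, which gives \<alpha>^-1
  and a full binomial count; with a 0, \<open>sum_survivors\<close> applies to the remaining rows
  \<open>A\<close>. The row index of \<open>E1\<close> is \<open>card A\<close>, one less than
  \<open>card U\<close>.\<close>

lemma sum_survivors_eq_E1:
  fixes \<alpha> \<beta> q :: "'a::field"
  assumes "\<beta> \<noteq> 0" "finite U" "0 \<in> U"
  shows "(\<Sum>S\<in>Pow U - {{}}. q ^ (card S - 1) * inverse \<alpha> ^ (if 0 \<in> S then 1 else 0) *
      inverse \<beta> ^ (card (survivors U S) - 1) * v (card (survivors U S) - 1)) =
    inverse \<beta> ^ (card U - 1) * mat_vec (E1 \<alpha> \<beta> q) v (card U - 1)"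
    (is "?lhs = _")
proof -
  define A where "A = U - {0}"
  have fin: "finite A" and U: "U = insert 0 A" and zero: "0 \<notin> A"
    using assms by (auto simp: A_def)
  have less: "\<And>a. a \<in> A \<Longrightarrow> 0 < a"
    by (auto simp: A_def)
  let ?i = "card A"
  let ?g = "\<lambda>j. inverse \<beta> ^ j * v j"
  have "?lhs = (\<Sum>S\<in>Pow A - {{}}. q ^ (card S - 1) * ?g (card (survivors A S))) +
    (\<Sum>S\<in>Pow A. inverse \<alpha> * q ^ card S * ?g (card S))"
    unfolding U sum_nonempty_subsets_insert[OF fin zero]
  proof (intro arg_cong2[where f = plus] sum.cong refl)
    fix S assume "S \<in> Pow A - {{}}"
    moreover from this have "0 \<notin> S" using zero by auto
    ultimately show "q ^ (card S - 1) * inverse \<alpha> ^ (if 0 \<in> S then 1 else 0) *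
        inverse \<beta> ^ (card (survivors (insert 0 A) S) - 1) * v (card (survivors (insert 0 A) S) - 1)
      = q ^ (card S - 1) * ?g (card (survivors A S))"
      by (simp add: card_survivors_insert_min[OF fin less])
  next
    fix S assume "S \<in> Pow A"
    moreover from this have "finite S" "0 \<notin> S"
      using fin zero by (auto intro: finite_subset)
    ultimately show "q ^ (card (insert 0 S) - 1) * inverse \<alpha> ^ (if 0 \<in> insert 0 S then 1 else 0) *
        inverse \<beta> ^ (card (survivors (insert 0 A) (insert 0 S)) - 1) *
        v (card (survivors (insert 0 A) (insert 0 S)) - 1)
      = inverse \<alpha> * q ^ card S * ?g (card S)"
      by (simp add: card_survivors_insert_min[OF fin less])
  qed
  also have "\<dots> = (\<Sum>j\<le>?i. (\<Sum>r<j. of_nat ((?i - j + r) choose r) * q ^ r) * ?g j) +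
      (\<Sum>j\<le>?i. of_nat (?i choose j) * (inverse \<alpha> * q ^ j * ?g j))"
    by (simp only: sum_survivors[OF fin, where g = ?g]
        sum_Pow_card[OF fin, where f = "\<lambda>j. inverse \<alpha> * q ^ j * ?g j"])
  also have "\<dots> = (\<Sum>j\<le>?i. inverse \<beta> ^ ?i * (E1 \<alpha> \<beta> q ?i j * v j))"
    unfolding sum.distrib[symmetric]
  proof (intro sum.cong refl)
    fix j assume "j \<in> {..?i}"
    then have j: "j \<le> ?i" by simp
    \<comment> \<open>Dropping from \<open>?i\<close> to \<open>j\<close> unrestricted rows besides
      the top one is the origin of the power of \<beta> in \<open>E1\<close>.\<close>
    have pow: "inverse \<beta> ^ j = inverse \<beta> ^ ?i * \<beta> ^ (?i - j)"
      using j assms(1) by (simp add: power_diff field_simps)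
    show "(\<Sum>r<j. of_nat ((?i - j + r) choose r) * q ^ r) * ?g j +
        of_nat (?i choose j) * (inverse \<alpha> * q ^ j * ?g j)
      = inverse \<beta> ^ ?i * (E1 \<alpha> \<beta> q ?i j * v j)"
      unfolding E1_def pow using j by (simp add: algebra_simps)
  qed
  also have "\<dots> = inverse \<beta> ^ ?i * mat_vec (E1 \<alpha> \<beta> q) v ?i"
    by (simp add: mat_vec_eq_sum[OF _ E1_support] sum_distrib_left)
  finally show ?thesis
    using fin zero by (simp add: U)
qed

section \<open>Permutation tableaux along the boundary path\<close>

definition unrestricted_rows :: "nat list \<Rightarrow> filling \<Rightarrow> nat set" where
  "unrestricted_rows lam T = {i. i < length lam \<and> (\<forall>j. \<not> restricted lam T i j)}"

text \<open>Since \<open>unr\<close> already subtracts one, it is the matrix index counted from 0. A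
  general \<open>v\<close> allows the last step of the path to be absorbed into the vector.\<close>

definition state_sum :: "'a::field \<Rightarrow> 'a \<Rightarrow> 'a \<Rightarrow> nat list \<Rightarrow> 'a inf_vec \<Rightarrow> 'a" where
  "state_sum \<alpha> \<beta> q lam v =
     (\<Sum>T\<in>permutation_tableaux lam. tableau_weight \<alpha> \<beta> q lam T * v (unr lam T))"

lemma F_shape_eq_state_sum: "F_shape \<alpha> \<beta> q lam = state_sum \<alpha> \<beta> q lam V1"
  by (simp add: F_shape_def state_sum_def V1_def)

lemma finite_boxes: "finite (boxes lam)"
proof -
  have "boxes lam = (SIGMA i:{..<length lam}. {..<lam ! i})"
    by (auto simp: boxes_def)
  then show ?thesis by simp
qed

lemma finite_permutation_tableaux: "finite (permutation_tableaux lam)"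
proof (rule finite_subset)
  show "permutation_tableaux lam \<subseteq> boxes lam \<rightarrow>\<^sub>E {0, 1}"
    by (auto simp: permutation_tableaux_def)
  show "finite (boxes lam \<rightarrow>\<^sub>E {0 :: nat, 1})"
    by (intro finite_PiE finite_boxes) simp
qed

lemma unr_eq: "unr lam T = card (unrestricted_rows lam T) - 1"
  by (simp add: unr_def unrestricted_rows_def)

lemma finite_unrestricted_rows: "finite (unrestricted_rows lam T)"
  by (simp add: unrestricted_rows_def)

lemma zero_in_unrestricted_rows: "lam \<noteq> [] \<Longrightarrow> 0 \<in> unrestricted_rows lam T"
  by (simp add: unrestricted_rows_def restricted_def one_above_def)

text \<open>Each column contains a 1, so projecting the ones to their columns is onto. This makes
  the truncated subtraction in \<open>wt\<close> exact.\<close>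

lemma num_columns_le_card_ones:
  assumes "T \<in> permutation_tableaux lam"
  shows "num_columns lam \<le> card {b \<in> boxes lam. T b = 1}"
proof -
  have "{..<num_columns lam} \<subseteq> snd ` {b \<in> boxes lam. T b = 1}"
  proof
    fix j assume "j \<in> {..<num_columns lam}"
    then obtain i where "(i, j) \<in> {b \<in> boxes lam. T b = 1}"
      using assms unfolding permutation_tableaux_def by blast
    then show "j \<in> snd ` {b \<in> boxes lam. T b = 1}"
      by (rule rev_image_eqI) simp
  qed
  then have "card {..<num_columns lam} \<le> card {b \<in> boxes lam. T b = 1}"
    by (rule surj_card_le[rotated]) (simp add: finite_boxes)
  then show ?thesis by simp
qed

section \<open>Appending an empty row: the action of \<open>D1\<close>\<close>

lemma boxes_append_zero: "boxes (lam @ [0]) = boxes lam"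
  by (auto simp: boxes_def nth_append less_Suc_eq)

lemma num_columns_append_zero: "num_columns (lam @ [0]) = num_columns lam"
  by (cases lam) auto

lemma permutation_tableaux_append_zero:
  "permutation_tableaux (lam @ [0]) = permutation_tableaux lam"
  by (simp add: permutation_tableaux_def one_above_def one_left_def boxes_append_zero
      num_columns_append_zero)

text \<open>The new row has no entries and so none restricted. Row 0 of \<open>lam\<close> is
  unrestricted, so subtracting one does not truncate on either side.\<close>

lemma unr_append_zero:
  assumes "lam \<noteq> []"
  shows "unr (lam @ [0]) T = Suc (unr lam T)"
proof -
  have "unrestricted_rows (lam @ [0]) T = insert (length lam) (unrestricted_rows lam T)"
    by (auto simp: unrestricted_rows_def restricted_def one_above_def boxes_append_zero)
      (auto simp: boxes_def)
  moreover have "length lam \<notin> unrestricted_rows lam T"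
    by (simp add: unrestricted_rows_def)
  moreover have "card (unrestricted_rows lam T) > 0"
    using zero_in_unrestricted_rows[OF assms, of T] finite_unrestricted_rows[of lam T]
    by (auto simp: card_gt_0_iff)
  ultimately show ?thesis
    by (simp add: unr_eq finite_unrestricted_rows)
qed

lemma state_sum_append_zero:
  assumes "lam \<noteq> []"
  shows "state_sum \<alpha> \<beta> q (lam @ [0]) v = state_sum \<alpha> \<beta> q lam (mat_vec (D1 \<beta>) v)"
  unfolding state_sum_def permutation_tableaux_append_zero
  by (intro sum.cong refl)
    (simp add: tableau_weight_def unr_append_zero[OF assms] wt_def top_ones_def boxes_append_zero
      num_columns_append_zero mat_vec_D1)

section \<open>Prepending a full column: the action of \<open>E1\<close>\<close>

definition add_column :: "nat list \<Rightarrow> nat set \<Rightarrow> filling \<Rightarrow> filling" where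
  "add_column lam S T = (\<lambda>(i, j).
     case j of
       0 \<Rightarrow> (if i < length lam then (if i \<in> S then 1 else 0) else undefined)
     | Suc j' \<Rightarrow> T (i, j'))"

lemma add_column_simps [simp]:
  "add_column lam S T (i, 0) =
     (if i < length lam then (if i \<in> S then 1 else 0) else undefined)"
  "add_column lam S T (i, Suc j) = T (i, j)"
  by (simp_all add: add_column_def)

lemma boxes_map_Suc [simp]:
  "(i, 0) \<in> boxes (map Suc lam) \<longleftrightarrow> i < length lam"
  "(i, Suc j) \<in> boxes (map Suc lam) \<longleftrightarrow> (i, j) \<in> boxes lam"
  by (auto simp: boxes_def)

lemma num_columns_map_Suc: "lam \<noteq> [] \<Longrightarrow> num_columns (map Suc lam) = Suc (num_columns lam)"
  by (cases lam) auto

lemma boxes_row_less: "(i, j) \<in> boxes lam \<Longrightarrow> i < length lam"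
  by (simp add: boxes_def)

definition drop_column :: "filling \<Rightarrow> filling" where
  "drop_column T = (\<lambda>(i, j). T (i, Suc j))"

lemma drop_column_simp [simp]: "drop_column T (i, j) = T (i, Suc j)"
  by (simp add: drop_column_def)

lemma drop_column_add_column [simp]: "drop_column (add_column lam S T) = T"
  by (auto simp: fun_eq_iff)

lemma one_above_map_Suc [simp]:
  "one_above (map Suc lam) T i (Suc j) \<longleftrightarrow> one_above lam (drop_column T) i j"
  "i < length lam \<Longrightarrow> one_above (map Suc lam) T i 0 \<longleftrightarrow> (\<exists>i'<i. T (i', 0) = 1)"
  by (auto simp: one_above_def)

lemma one_left_map_Suc [simp]:
  "one_left (map Suc lam) T i (Suc j) \<longleftrightarrow>
     i < length lam \<and> T (i, 0) = 1 \<or> one_left lam (drop_column T) i j"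
  by (simp add: one_left_def Ex_less_Suc2)

lemma one_left_zero [simp]: "\<not> one_left lam T i 0"
  by (simp add: one_left_def)

lemma all_boxes_map_Suc:
  "(\<forall>(i, j)\<in>boxes (map Suc lam). P i j) \<longleftrightarrow>
     (\<forall>i<length lam. P i 0) \<and> (\<forall>(i, j)\<in>boxes lam. P i (Suc j))"
  (is "?L \<longleftrightarrow> ?R")
proof
  assume ?L
  then show ?R by fastforce
next
  assume R: ?R
  have "P i j" if "(i, j) \<in> boxes (map Suc lam)" for i j
    using R that by (cases j) auto
  then show ?L by auto
qed

lemma mem_fillings_map_Suc:
  "T \<in> boxes (map Suc lam) \<rightarrow>\<^sub>E {0, 1} \<longleftrightarrow>
     drop_column T \<in> boxes lam \<rightarrow>\<^sub>E {0, 1} \<and>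
     (\<forall>i. T (i, 0) \<in> (if i < length lam then {0, 1} else {undefined}))"
  (is "?L \<longleftrightarrow> ?R")
proof
  assume L: ?L
  have "T (i, 0) \<in> (if i < length lam then {0, 1} else {undefined})" for i
    using PiE_mem[OF L, of "(i, 0)"] PiE_arb[OF L, of "(i, 0)"] by auto
  moreover have "drop_column T \<in> boxes lam \<rightarrow>\<^sub>E {0, 1}"
  proof
    show "drop_column T b \<in> {0, 1}" if "b \<in> boxes lam" for b
      using that PiE_mem[OF L, of "(fst b, Suc (snd b))"] by (cases b) auto
    show "drop_column T b = undefined" if "b \<notin> boxes lam" for b
      using that PiE_arb[OF L, of "(fst b, Suc (snd b))"] by (cases b) auto
  qed
  ultimately show ?R by blast
next
  assume R: ?R
  then have D: "drop_column T \<in> boxes lam \<rightarrow>\<^sub>E {0, 1}"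
    and Z: "\<And>i. T (i, 0) \<in> (if i < length lam then {0, 1} else {undefined})"
    by blast+
  have mem: "T (i, j) \<in> {0, 1}" if "(i, j) \<in> boxes (map Suc lam)" for i j
    using that Z[of i] PiE_mem[OF D, of "(i, j - 1)"] by (cases j) auto
  have arb: "T (i, j) = undefined" if "(i, j) \<notin> boxes (map Suc lam)" for i j
    using that Z[of i] PiE_arb[OF D, of "(i, j - 1)"] by (cases j) auto
  show ?L
    by (rule PiE_I) (use mem arb in force)+
qed

text \<open>In the new column condition (2) is vacuous, since nothing lies to the left. In the old
  columns a new 1 lies to the left of every entry of its row, so it is forbidden exactly when that
  row has a restricted 0.\<close>

lemma mem_permutation_tableaux_map_Suc:
  assumes "lam \<noteq> []"
  shows "T \<in> permutation_tableaux (map Suc lam) \<longleftrightarrow>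
    drop_column T \<in> permutation_tableaux lam \<and>
    (\<forall>i. T (i, 0) \<in> (if i < length lam then {0, 1} else {undefined})) \<and>
    (\<exists>i<length lam. T (i, 0) = 1) \<and>
    {i. i < length lam \<and> T (i, 0) = 1} \<subseteq> unrestricted_rows lam (drop_column T)"
proof -
  have col: "{i. i < length lam \<and> T (i, 0) = 1} \<subseteq> unrestricted_rows lam (drop_column T) \<longleftrightarrow>
      (\<forall>(i, j)\<in>boxes lam. T (i, Suc j) = 0 \<longrightarrow> one_above lam (drop_column T) i j \<longrightarrow> T (i, 0) \<noteq> 1)"
    unfolding unrestricted_rows_def restricted_def drop_column_simp subset_iff mem_Collect_eq
      Ball_def split_paired_All prod.case
    using boxes_row_less[of _ _ lam] by blast
  show ?thesis
    unfolding col permutation_tableaux_def mem_Collect_eq mem_fillings_map_Suc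
      num_columns_map_Suc[OF assms] All_less_Suc2 all_boxes_map_Suc
    by (auto dest: boxes_row_less)
qed

text \<open>The inverse deletes column 0 and records the rows where it had a 1.\<close>

lemma bij_betw_add_column:
  assumes "lam \<noteq> []"
  shows "bij_betw (\<lambda>(T, S). add_column lam S T)
    (SIGMA T:permutation_tableaux lam. Pow (unrestricted_rows lam T) - {{}})
    (permutation_tableaux (map Suc lam))"
proof (rule bij_betw_byWitness
    [where f' = "\<lambda>T. (drop_column T, {i. i < length lam \<and> T (i, 0) = 1})"])
  have less: "i < length lam" if "S \<subseteq> unrestricted_rows lam T" "i \<in> S" for S T i
    using that by (auto simp: unrestricted_rows_def)
  show "\<forall>a\<in>SIGMA T:permutation_tableaux lam. Pow (unrestricted_rows lam T) - {{}}.
      (\<lambda>T. (drop_column T, {i. i < length lam \<and> T (i, 0) = 1}))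
        ((\<lambda>(T, S). add_column lam S T) a) = a"
    using less by auto
  show "(\<lambda>(T, S). add_column lam S T) `
      (SIGMA T:permutation_tableaux lam. Pow (unrestricted_rows lam T) - {{}})
    \<subseteq> permutation_tableaux (map Suc lam)"
  proof (rule image_subsetI)
    fix p assume "p \<in> (SIGMA T:permutation_tableaux lam. Pow (unrestricted_rows lam T) - {{}})"
    then obtain T S where p: "p = (T, S)" and T: "T \<in> permutation_tableaux lam"
      and S: "S \<subseteq> unrestricted_rows lam T" "S \<noteq> {}"
      by auto
    have "{i. i < length lam \<and> add_column lam S T (i, 0) = 1} = S"
      using less[OF S(1)] by auto
    moreover from this have "\<exists>i<length lam. add_column lam S T (i, 0) = 1"
      using S(2) by blast
    ultimately show "(\<lambda>(T, S). add_column lam S T) p \<in> permutation_tableaux (map Suc lam)"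
      using T S(1) unfolding p prod.case mem_permutation_tableaux_map_Suc[OF assms] by simp
  qed
  show "\<forall>T\<in>permutation_tableaux (map Suc lam). (\<lambda>(T, S). add_column lam S T)
      (drop_column T, {i. i < length lam \<and> T (i, 0) = 1}) = T"
  proof
    fix T assume "T \<in> permutation_tableaux (map Suc lam)"
    then have Z: "T (i, 0) \<in> (if i < length lam then {0, 1} else {undefined})" for i
      by (simp add: mem_permutation_tableaux_map_Suc[OF assms])
    have "add_column lam {i. i < length lam \<and> T (i, 0) = 1} (drop_column T) (i, j) = T (i, j)"
      for i j using Z[of i] by (cases j) (auto split: if_splits)
    then show "(\<lambda>(T, S). add_column lam S T)
        (drop_column T, {i. i < length lam \<and> T (i, 0) = 1}) = T"
      by auto
  qed
  show "(\<lambda>T. (drop_column T, {i. i < length lam \<and> T (i, 0) = 1})) `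
      permutation_tableaux (map Suc lam)
    \<subseteq> (SIGMA T:permutation_tableaux lam. Pow (unrestricted_rows lam T) - {{}})"
    by (auto simp: mem_permutation_tableaux_map_Suc[OF assms])
qed

text \<open>Old entries keep everything above them, so their status does not change; only the new
  entry of a row can make it restricted.\<close>

lemma unrestricted_rows_add_column:
  assumes "S \<subseteq> unrestricted_rows lam T"
  shows "unrestricted_rows (map Suc lam) (add_column lam S T) =
    survivors (unrestricted_rows lam T) S"
proof -
  have S: "i < length lam" if "i \<in> S" for i
    using assms that by (auto simp: unrestricted_rows_def)
  have col: "restricted (map Suc lam) (add_column lam S T) i 0 \<longleftrightarrow>
      i \<notin> S \<and> (\<exists>s\<in>S. s < i)" if "i < length lam" for i
    using that S by (auto simp: restricted_def)
  have rest: "restricted (map Suc lam) (add_column lam S T) i (Suc j) \<longleftrightarrow> restricted lam T i j" for i j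
    by (simp add: restricted_def)
  have "(\<forall>j. \<not> restricted (map Suc lam) (add_column lam S T) i j) \<longleftrightarrow>
      (i \<in> S \<or> (\<forall>s\<in>S. i \<le> s)) \<and> (\<forall>j. \<not> restricted lam T i j)" if "i < length lam" for i
  proof -
    have "(\<forall>j. P j) \<longleftrightarrow> P 0 \<and> (\<forall>j. P (Suc j))" for P :: "nat \<Rightarrow> bool"
      by (metis not0_implies_Suc)
    from this[of "\<lambda>j. \<not> restricted (map Suc lam) (add_column lam S T) i j"] show ?thesis
      by (auto simp: col[OF that] rest not_less)
  qed
  then show ?thesis
    by (auto simp: unrestricted_rows_def survivors_def)
qed

text \<open>There are \<open>card S\<close> additional ones and one additional column to
  subtract.\<close>

lemma wt_add_column:
  assumes "lam \<noteq> []" "T \<in> permutation_tableaux lam" "S \<subseteq> unrestricted_rows lam T" "S \<noteq> {}"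
  shows "wt (map Suc lam) (add_column lam S T) = wt lam T + (card S - 1)"
proof -
  let ?O = "{b \<in> boxes lam. T b = 1}"
  have S: "i < length lam" if "i \<in> S" for i
    using assms(3) that by (auto simp: unrestricted_rows_def)
  have ones: "{b \<in> boxes (map Suc lam). add_column lam S T b = 1} =
      (\<lambda>i. (i, 0)) ` S \<union> (\<lambda>(i, j). (i, Suc j)) ` ?O" (is "?A = ?B")
  proof -
    have "(i, j) \<in> ?A \<longleftrightarrow> (i, j) \<in> ?B" for i j
      by (cases j) (auto simp: S split: if_splits)
    then show ?thesis by auto
  qed
  have "finite S"
    by (rule finite_subset[OF assms(3) finite_unrestricted_rows])
  have "card ?B = card ((\<lambda>i. (i, 0::nat)) ` S) + card ((\<lambda>(i, j). (i, Suc j)) ` ?O)"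
    using \<open>finite S\<close> finite_boxes[of lam] by (intro card_Un_disjoint) auto
  also have "\<dots> = card S + card ?O"
    by (intro arg_cong2[where f = plus] card_image) (auto simp: inj_on_def)
  finally have "card ?A = card S + card ?O"
    unfolding ones .
  moreover have "card S > 0"
    using \<open>finite S\<close> assms(4) by (simp add: card_gt_0_iff)
  ultimately show ?thesis
    using num_columns_le_card_ones[OF assms(2)] by (simp add: wt_def num_columns_map_Suc[OF assms(1)])
qed

lemma top_ones_add_column:
  assumes "lam \<noteq> []"
  shows "top_ones (map Suc lam) (add_column lam S T) = top_ones lam T + (if 0 \<in> S then 1 else 0)"
proof -
  let ?O = "{j. (0, j) \<in> boxes lam \<and> T (0, j) = 1}"
  have "{j. (0, j) \<in> boxes (map Suc lam) \<and> add_column lam S T (0, j) = 1} =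
      (if 0 \<in> S then {0} else {}) \<union> Suc ` ?O" (is "?A = ?B")
  proof -
    have "j \<in> ?A \<longleftrightarrow> j \<in> ?B" for j
      using assms by (cases j) (auto split: if_splits)
    then show ?thesis by auto
  qed
  moreover have "finite ?O"
    by (rule finite_subset[of _ "{..<lam ! 0}"]) (auto simp: boxes_def)
  ultimately show ?thesis
    by (simp add: top_ones_def card_image)
qed

lemma state_sum_map_Suc:
  assumes "\<beta> \<noteq> 0" "lam \<noteq> []"
  shows "state_sum \<alpha> \<beta> q (map Suc lam) v = state_sum \<alpha> \<beta> q lam (mat_vec (E1 \<alpha> \<beta> q) v)"
proof -
  let ?U = "unrestricted_rows lam"
  have "state_sum \<alpha> \<beta> q (map Suc lam) v =
    (\<Sum>(T, S)\<in>(SIGMA T:permutation_tableaux lam. Pow (?U T) - {{}}).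
      tableau_weight \<alpha> \<beta> q (map Suc lam) (add_column lam S T) *
      v (unr (map Suc lam) (add_column lam S T)))"
    unfolding state_sum_def
    by (subst sum.reindex_bij_betw[OF bij_betw_add_column[OF assms(2)], symmetric])
      (simp add: case_prod_unfold)
  also have "\<dots> = (\<Sum>T\<in>permutation_tableaux lam. \<Sum>S\<in>Pow (?U T) - {{}}.
      tableau_weight \<alpha> \<beta> q (map Suc lam) (add_column lam S T) *
      v (unr (map Suc lam) (add_column lam S T)))"
    by (rule sum.Sigma[symmetric]) (auto simp: finite_permutation_tableaux finite_unrestricted_rows)
  also have "\<dots> = (\<Sum>T\<in>permutation_tableaux lam. q ^ wt lam T * inverse \<alpha> ^ top_ones lam T *
      (\<Sum>S\<in>Pow (?U T) - {{}}. q ^ (card S - 1) * inverse \<alpha> ^ (if 0 \<in> S then 1 else 0) *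
      inverse \<beta> ^ (card (survivors (?U T) S) - 1) * v (card (survivors (?U T) S) - 1)))"
    unfolding sum_distrib_left
    by (intro sum.cong refl)
      (simp add: tableau_weight_def wt_add_column[OF assms(2)] top_ones_add_column[OF assms(2)]
        unr_eq unrestricted_rows_add_column power_add mult_ac del: power_inverse)
  \<comment> \<open>The power of \<open>inverse \<beta>\<close> produced by
    \<open>sum_survivors_eq_E1\<close> has exponent \<open>unr lam T\<close> and completes the
    weight of \<open>T\<close>.\<close>
  also have "\<dots> = state_sum \<alpha> \<beta> q lam (mat_vec (E1 \<alpha> \<beta> q) v)"
    unfolding state_sum_def
    by (intro sum.cong refl)
      (simp only: sum_survivors_eq_E1[OF assms(1) finite_unrestricted_rows
          zero_in_unrestricted_rows[OF assms(2)]], simp only: tableau_weight_def unr_eq mult.assoc)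
  finally show ?thesis .
qed

text \<open>Base of the inductions: the path consisting of the initial South step alone. The only
  tableau is empty, of weight 1 and state 0.\<close>

lemma state_sum_singleton_zero: "state_sum \<alpha> \<beta> q [0] v = v 0"
proof -
  have boxes: "boxes [0] = {}"
    by (auto simp: boxes_def)
  then have "permutation_tableaux [0] = {\<lambda>_. undefined}"
    by (auto simp: permutation_tableaux_def)
  then show ?thesis
    by (simp add: state_sum_def tableau_weight_def wt_def top_ones_def unr_def restricted_def boxes)
qed

section \<open>Partitions and boundary words\<close>

lemma is_partition_append_zero: "is_partition (lam @ [0]) \<longleftrightarrow> is_partition lam"
  by (simp add: is_partition_def sorted_wrt_append)

lemma is_partition_map_Suc: "is_partition (map Suc lam) \<longleftrightarrow> is_partition lam"
  by (simp add: is_partition_def sorted_wrt_map)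

lemma expanse_append_zero: "expanse (lam @ [0]) = Suc (expanse lam)"
  by (simp add: expanse_def num_columns_append_zero)

lemma expanse_map_Suc: "lam \<noteq> [] \<Longrightarrow> expanse (map Suc lam) = Suc (expanse lam)"
  by (simp add: expanse_def num_columns_map_Suc)

lemma boundary_append_zero: "boundary (lam @ [0]) = boundary lam @ [South]"
  by (induction lam) (auto simp: num_columns_append_zero)

text \<open>Differences of consecutive parts are unchanged; only the final run of West steps, whose
  length is the last part, grows by one.\<close>

lemma boundary_map_Suc: "lam \<noteq> [] \<Longrightarrow> boundary (map Suc lam) = boundary lam @ [West]"
proof (induction lam)
  case (Cons a lam)
  then show ?case
    by (cases lam) (auto simp: replicate_append_same)
qed simp

text \<open>The last letter of the path is South iff the last part is 0. Otherwise the last part,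
  being the smallest, forces all parts to be positive.\<close>

lemma partition_cases:
  assumes "is_partition lam" "lam \<noteq> []"
  obtains mu where "lam = mu @ [0]" "is_partition mu"
    | mu where "lam = map Suc mu" "is_partition mu" "mu \<noteq> []"
proof (cases "last lam = 0")
  case True
  then show ?thesis
    using that(1)[of "butlast lam"] assms append_butlast_last_id[OF assms(2)]
      is_partition_append_zero[of "butlast lam"] by simp
next
  case False
  have "sorted_wrt (\<ge>) (butlast lam @ [last lam])"
    using assms by (simp add: is_partition_def)
  then have "\<forall>x\<in>set (butlast lam @ [last lam]). last lam \<le> x"
    unfolding sorted_wrt_append by simp
  then have "last lam \<le> x" if "x \<in> set lam" for x
    using that assms(2) by simp
  then have "0 < x" if "x \<in> set lam" for x
    using False that by fastforce
  then have "lam = map Suc (map (\<lambda>x. x - 1) lam)"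
    by (simp add: map_idI)
  then show ?thesis
    using that(2)[of "map (\<lambda>x. x - 1) lam"] assms is_partition_map_Suc[of "map (\<lambda>x. x - 1) lam"]
    by simp
qed

section \<open>All shapes of a fixed expanse\<close>

definition partitions_of_expanse :: "nat \<Rightarrow> nat list set" where
  "partitions_of_expanse N = {lam. is_partition lam \<and> expanse lam = N}"

lemma partitions_of_expanse_1: "partitions_of_expanse (Suc 0) = {[0]}"
proof -
  have "lam = [0]" if "expanse lam = Suc 0" for lam
    using that by (cases lam) (auto simp: expanse_def)
  then show ?thesis
    by (auto simp: partitions_of_expanse_def) (simp_all add: is_partition_def expanse_def)
qed

lemma partitions_of_expanse_nonempty: "lam \<in> partitions_of_expanse (Suc n) \<Longrightarrow> lam \<noteq> []"
  by (auto simp: partitions_of_expanse_def expanse_def)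

lemma partitions_of_expanse_Suc:
  "partitions_of_expanse (Suc (Suc n)) =
     (\<lambda>lam. lam @ [0]) ` partitions_of_expanse (Suc n) \<union> map Suc ` partitions_of_expanse (Suc n)"
  (is "?L = ?R")
proof
  show "?L \<subseteq> ?R"
  proof
    fix lam assume lam: "lam \<in> ?L"
    then have "is_partition lam" "lam \<noteq> []"
      using partitions_of_expanse_nonempty by (auto simp: partitions_of_expanse_def)
    then show "lam \<in> ?R"
      by (cases rule: partition_cases)
        (use lam in \<open>auto simp: partitions_of_expanse_def expanse_append_zero expanse_map_Suc\<close>)
  qed
  show "?R \<subseteq> ?L"
    using partitions_of_expanse_nonempty
    by (auto simp: partitions_of_expanse_def is_partition_append_zero is_partition_map_Suc
        expanse_append_zero expanse_map_Suc)
qed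

lemma finite_partitions_of_expanse: "finite (partitions_of_expanse (Suc n))"
  by (induction n) (simp_all add: partitions_of_expanse_1 partitions_of_expanse_Suc)

lemma sum_partitions_of_expanse_Suc:
  "(\<Sum>lam\<in>partitions_of_expanse (Suc (Suc n)). f lam) =
     (\<Sum>lam\<in>partitions_of_expanse (Suc n). f (lam @ [0]) + f (map Suc lam) :: 'a::comm_monoid_add)"
proof -
  \<comment> \<open>The two families are disjoint: the last part is 0 in one and positive in the
    other.\<close>
  have "mu @ [0] \<noteq> map Suc lam" for mu lam
    by (cases lam rule: rev_cases) auto
  then have "(\<lambda>lam. lam @ [0]) ` partitions_of_expanse (Suc n) \<inter>
      map Suc ` partitions_of_expanse (Suc n) = {}"
    by auto
  moreover have "inj_on (\<lambda>lam. lam @ [0]) A" "inj_on (map Suc) A" for A :: "nat list set"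
    by (auto simp: inj_on_def)
  ultimately show ?thesis
    unfolding partitions_of_expanse_Suc
    by (subst sum.union_disjoint)
      (auto simp: finite_partitions_of_expanse sum.reindex sum.distrib)
qed

lemma F_expanse_eq_state_sum:
  "F_expanse \<alpha> \<beta> q (Suc n) = (\<Sum>lam\<in>partitions_of_expanse (Suc n). state_sum \<alpha> \<beta> q lam V1)"
proof -
  have "tableaux_of_expanse (Suc n) = (SIGMA lam:partitions_of_expanse (Suc n). permutation_tableaux lam)"
    by (auto simp: tableaux_of_expanse_def partitions_of_expanse_def)
  then show ?thesis
    unfolding F_expanse_def F_shape_eq_state_sum[symmetric] F_shape_def
    by (simp add: sum.Sigma finite_partitions_of_expanse finite_permutation_tableaux)
qed

text \<open>Every shape extends by either letter, and \<open>state_sum\<close> is linear in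
  \<open>v\<close>, so the two extensions together apply \<open>D1 + E1\<close> to
  \<open>v\<close>.\<close>

lemma sum_state_sum_eq_mat_vec:
  assumes "\<beta> \<noteq> 0"
  shows "(\<Sum>lam\<in>partitions_of_expanse (Suc n). state_sum \<alpha> \<beta> q lam v) =
    foldr mat_vec (replicate n (mat_add (D1 \<beta>) (E1 \<alpha> \<beta> q))) v 0"
proof (induction n arbitrary: v)
  case 0
  then show ?case by (simp add: partitions_of_expanse_1 state_sum_singleton_zero)
next
  case (Suc n)
  let ?M = "mat_add (D1 \<beta>) (E1 \<alpha> \<beta> q)"
  have "state_sum \<alpha> \<beta> q (lam @ [0]) v + state_sum \<alpha> \<beta> q (map Suc lam) v =
      state_sum \<alpha> \<beta> q lam (mat_vec ?M v)" if "lam \<in> partitions_of_expanse (Suc n)" for lam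
    unfolding state_sum_append_zero[OF partitions_of_expanse_nonempty[OF that]]
      state_sum_map_Suc[OF assms partitions_of_expanse_nonempty[OF that]]
    by (simp add: state_sum_def mat_vec_mat_add[OF row_finite_D1 row_finite_E1]
        sum.distrib[symmetric] distrib_left)
  then have "(\<Sum>lam\<in>partitions_of_expanse (Suc (Suc n)). state_sum \<alpha> \<beta> q lam v) =
      (\<Sum>lam\<in>partitions_of_expanse (Suc n). state_sum \<alpha> \<beta> q lam (mat_vec ?M v))"
    unfolding sum_partitions_of_expanse_Suc by (rule sum.cong[OF refl])
  \<comment> \<open>The induction hypothesis is used at \<open>mat_vec ?M v\<close>, so the new
    factor is the innermost one.\<close>
  also have "\<dots> = foldr mat_vec (replicate n ?M @ [?M]) v 0"
    by (simp add: Suc.IH)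
  finally show ?case
    by (simp only: replicate_append_same replicate_Suc)
qed

section \<open>The matrix product of a single shape\<close>

definition step_mat :: "'a::field \<Rightarrow> 'a \<Rightarrow> 'a \<Rightarrow> step \<Rightarrow> 'a inf_mat" where
  "step_mat \<alpha> \<beta> q s = (if s = South then D1 \<beta> else E1 \<alpha> \<beta> q)"

text \<open>Induction on the last letter of the path, whose matrix acts on \<open>v\<close> first.
  The tail omits the initial South step, which is accounted for by the starting shape
  \<open>[0]\<close>.\<close>

lemma state_sum_eq_mat_vec:
  assumes "\<beta> \<noteq> 0" "lam \<in> partitions_of_expanse (Suc n)"
  shows "state_sum \<alpha> \<beta> q lam v = foldr mat_vec (map (step_mat \<alpha> \<beta> q) (tl (boundary lam))) v 0"
  using assms(2)
proof (induction n arbitrary: lam v)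
  case 0
  then show ?case by (simp add: partitions_of_expanse_1 state_sum_singleton_zero)
next
  case (Suc n)
  then obtain mu where mu: "mu \<in> partitions_of_expanse (Suc n)"
    and lam: "lam = mu @ [0] \<or> lam = map Suc mu"
    by (auto simp: partitions_of_expanse_Suc)
  have nonempty: "mu \<noteq> []" and tl: "boundary mu \<noteq> []"
    using partitions_of_expanse_nonempty[OF mu] by (cases mu; simp)+
  from lam show ?case
    using Suc.IH[OF mu] nonempty tl assms(1)
    by (auto simp: boundary_append_zero boundary_map_Suc state_sum_append_zero state_sum_map_Suc
        step_mat_def)
qed

text \<open>Position \<open>i\<close> of the boundary word is position \<open>i - 1\<close> of its
  tail, which matches the range starting at 1; the value of \<open>phi\<close> cancels one of the
  two summands.\<close>

lemma phi_mat_eq_step_mat: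
  assumes "length (boundary lam) = n + 1"
  shows "map (\<lambda>i. mat_add (mat_scale (phi lam i) (D1 \<beta>))
      (mat_scale (1 - phi lam i) (E1 \<alpha> \<beta> q))) [1..<n + 1] =
    map (step_mat \<alpha> \<beta> q) (tl (boundary lam))"
  using assms
  by (intro nth_equalityI)
    (simp_all add: nth_tl phi_def step_mat_def mat_add_def mat_scale_def fun_eq_iff del: upt_Suc)

theorem theorem3p1:
  fixes \<alpha> \<beta> q :: "'a::field" and n :: nat
  assumes "\<alpha> \<noteq> 0" and "\<beta> \<noteq> 0" and "n \<ge> 1"
  shows "(\<forall>lam. is_partition lam \<and> expanse lam = n + 1 \<longrightarrow>
            F_shape \<alpha> \<beta> q lam =
              row_mat_col W1
                (mat_prod_list
                  (map (\<lambda>i. mat_add (mat_scale (phi lam i) (D1 \<beta>))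
                                   (mat_scale (1 - phi lam i) (E1 \<alpha> \<beta> q))) [1..<n + 1]))
                V1) \<and>
         F_expanse \<alpha> \<beta> q (n + 1) =
           row_mat_col W1 (mat_pow (mat_add (D1 \<beta>) (E1 \<alpha> \<beta> q)) n) V1"
proof (intro conjI allI impI)
  fix lam assume lam: "is_partition lam \<and> expanse lam = n + 1"
  have finite: "row_finite A" if "A \<in> set (map (step_mat \<alpha> \<beta> q) (tl (boundary lam)))" for A
    using that by (auto simp: step_mat_def row_finite_D1 row_finite_E1 split: if_splits)
  have "lam \<in> partitions_of_expanse (Suc n)"
    using lam by (simp add: partitions_of_expanse_def)
  then show "F_shape \<alpha> \<beta> q lam = row_mat_col W1
      (mat_prod_list
        (map (\<lambda>i. mat_add (mat_scale (phi lam i) (D1 \<beta>))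
                         (mat_scale (1 - phi lam i) (E1 \<alpha> \<beta> q))) [1..<n + 1])) V1"
    using lam unfolding F_shape_eq_state_sum row_mat_col_W1
    by (subst phi_mat_eq_step_mat)
      (simp_all only: length_boundary mat_vec_mat_prod_list[OF finite] state_sum_eq_mat_vec[OF assms(2)])
next
  have "row_finite (mat_add (D1 \<beta>) (E1 \<alpha> \<beta> q))"
    by (intro row_finite_mat_add row_finite_D1 row_finite_E1)
  then have "mat_vec (mat_pow (mat_add (D1 \<beta>) (E1 \<alpha> \<beta> q)) n) V1 =
      foldr mat_vec (replicate n (mat_add (D1 \<beta>) (E1 \<alpha> \<beta> q))) V1"
    unfolding mat_pow_eq_mat_prod_list by (intro mat_vec_mat_prod_list) simp
  then show "F_expanse \<alpha> \<beta> q (n + 1) =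
      row_mat_col W1 (mat_pow (mat_add (D1 \<beta>) (E1 \<alpha> \<beta> q)) n) V1"
    by (simp add: row_mat_col_W1 F_expanse_eq_state_sum sum_state_sum_eq_mat_vec[OF assms(2)])
qed

end
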